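(* Among all approximations of the form $\frac{1}{e}\left(1+\frac{1}{n}\right)^{n}\approx\frac{n+a}{n+b}$ as $n\to\infty$, with $a,b$ real constants, the best one is obtained for $a=\frac{5}{12}$ and $b=\frac{11}{12}$. That is, if for real $a,b$ and all sufficiently large integers $n$ the relative error $w_n(a,b)$ is defined by $$\frac{1}{e}\left(1+\frac{1}{n}\right)^{n}=\frac{n+a}{n+b}\cdot\exp\bigl(w_n(a,b)\bigr),$$ then for every pair $(a,b)\in\mathbb{R}^2$ with $(a,b)\neq\left(\frac{5}{12},\frac{11}{12}\right)$, the sequence $w_n\left(\frac{5}{12},\frac{11}{12}\right)$ converges to zero faster than $w_n(a,b)$, i.e. $w_n\left(\frac{5}{12},\frac{11}{12}\right)=o\bigl(w_n(a,b)\bigr)$ as $n\to\infty$.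
   Context: An approximation is considered better when its relative error sequence $w_n$ converges to zero faster. Equivalently, $w_n(a,b)=n\ln\left(1+\frac1n\right)-1-\ln\frac{n+a}{n+b}$, which is well defined as soon as $n>\max(-a,-b)$. *)

theory Defs
  imports Complex_Main "HOL-Library.Landau_Symbols"
begin

text \<open>The equation characterising the relative error is solvable for large \<open>n\<close>; its solution there
  is the following closed form.\<close>

lemma relative_error_equation_iff:
  fixes a b x :: real and n :: nat
  assumes "real n > max (- a) (- b)" "n > 0"
  shows "1 / exp 1 * (1 + 1 / real n) ^ n = (real n + a) / (real n + b) * exp x
    \<longleftrightarrow> x = real n * ln (1 + 1 / real n) - 1 - ln ((real n + a) / (real n + b))"
proof -
  define q where "q = (real n + a) / (real n + b)"
  have q: "q > 0" using assms by (simp add: q_def)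
  have "1 + 1 / real n > 0" by (simp add: add_pos_nonneg)
  hence l: "1 / exp 1 * (1 + 1 / real n) ^ n = exp (real n * ln (1 + 1 / real n) - 1)"
    by (simp add: exp_diff exp_of_nat_mult)
  have r: "q * exp x = exp (ln q + x)" using q by (simp add: exp_add)
  show ?thesis unfolding q_def[symmetric] l r by auto
qed

end

theory Submission
  imports Defs "HOL-Real_Asymp.Real_Asymp"
begin

text \<open>
  Expanding the logarithms in powers of \<open>1 / n\<close> shows that the relative error satisfies
  \[ w_n(a,b) = \frac{b - a - 1/2}{n} + \frac{1/3 + (a^2 - b^2)/2}{n^2} + o(1/n^2). \]
  Both coefficients vanish exactly when \<open>b - a = 1/2\<close> and \<open>b + a = 4/3\<close>, that is, for
  \<open>a = 5/12\<close> and \<open>b = 11/12\<close>.  At this pair the error is \<open>o(1/n\<^sup>2)\<close>; at every other pair one of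
  the two terms survives, so the error is bounded below by a constant multiple of \<open>1/n\<^sup>2\<close>.
  The expansion is lemma \<open>relative_error_expansion\<close>, and \<open>relative_error_lower_bound\<close> draws the
  second conclusion from it.
\<close>

lemma ln_one_plus_over_expansion:
  fixes c :: real
  shows "(\<lambda>n::nat. (real n)\<^sup>2 * ln (1 + c / real n) - c * real n) \<longlonglongrightarrow> - (c\<^sup>2 / 2)"
proof (cases "c = 0")
  case True
  then show ?thesis by simp
next
  case False
  \<comment> \<open>The automatic expansion has to know the sign of every coefficient it meets.\<close>
  consider "c > 0" | "c < 0" using False by linarith
  then show ?thesis
    by cases (real_asymp simp: power2_eq_square)+
qed

lemma relative_error_expansion:
  fixes a b :: real and v :: "nat \<Rightarrow> real"
  assumes v: "\<forall>\<^sub>F n in sequentially.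
      1 / exp 1 * (1 + 1 / real n) ^ n = (real n + a) / (real n + b) * exp (v n)"
  shows "(\<lambda>n. (real n)\<^sup>2 * v n - (b - a - 1 / 2) * real n) \<longlonglongrightarrow> 1 / 3 + (a\<^sup>2 - b\<^sup>2) / 2"
proof -
  let ?L = "\<lambda>c n. (real n)\<^sup>2 * ln (1 + c / real n) - c * real n"
  let ?E = "\<lambda>n. (real n)\<^sup>2 * (real n * ln (1 + 1 / real n) - 1) + real n / 2"
  have "?E \<longlonglongrightarrow> 1 / 3"
    by real_asymp
  from tendsto_add[OF tendsto_diff[OF this ln_one_plus_over_expansion[of a]]
      ln_one_plus_over_expansion[of b]]
  have lim: "(\<lambda>n. ?E n - ?L a n + ?L b n) \<longlonglongrightarrow> 1 / 3 + (a\<^sup>2 - b\<^sup>2) / 2"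
    by (simp add: diff_divide_distrib add_diff_eq)
  have "\<forall>\<^sub>F n in sequentially. real n > max (max (- a) (- b)) 0"
    by real_asymp
  with v have "\<forall>\<^sub>F n in sequentially.
      ?E n - ?L a n + ?L b n = (real n)\<^sup>2 * v n - (b - a - 1 / 2) * real n"
  proof eventually_elim
    case (elim n)
    have pos: "real n > 0" "real n + a > 0" "real n + b > 0"
      using elim by auto
    have vn: "v n = real n * ln (1 + 1 / real n) - 1 - ln ((real n + a) / (real n + b))"
      using relative_error_equation_iff[of a b n "v n"] elim by simp
    have split: "ln (1 + c / real n) = ln (real n + c) - ln (real n)" if "real n + c > 0" for c
    proof -
      have "1 + c / real n = (real n + c) / real n"
        using pos by (simp add: field_simps)
      then show ?thesis
        using pos that by (simp add: ln_div)
    qed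
    have "v n = real n * ln (1 + 1 / real n) - 1 - ln (1 + a / real n) + ln (1 + b / real n)"
      using pos by (simp add: vn split[of a] split[of b] ln_div)
    then show ?case
      by (simp only:) (simp add: algebra_simps)
  qed
  with lim show ?thesis
    by (rule Lim_transform_eventually)
qed

text \<open>If the leading coefficient \<open>b - a - 1/2\<close> is non-zero, \<open>n\<^sup>2 w_n\<close> even diverges; otherwise it
  converges to the second coefficient, which is then non-zero.\<close>

lemma relative_error_lower_bound:
  fixes a b :: real and v :: "nat \<Rightarrow> real"
  assumes v: "\<forall>\<^sub>F n in sequentially.
      1 / exp 1 * (1 + 1 / real n) ^ n = (real n + a) / (real n + b) * exp (v n)"
    and ab: "(a, b) \<noteq> (5 / 12, 11 / 12)"
  shows "(\<lambda>n. 1 / (real n)\<^sup>2) \<in> O(v)"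
proof -
  define p where "p = b - a - 1 / 2"
  define q where "q = 1 / 3 + (a\<^sup>2 - b\<^sup>2) / 2"
  have lim: "(\<lambda>n. (real n)\<^sup>2 * v n - p * real n) \<longlonglongrightarrow> q"
    using relative_error_expansion[OF v] by (simp add: p_def q_def)
  show ?thesis
  proof (cases "p = 0")
    case True
    then have b: "b = a + 1 / 2"
      by (simp add: p_def)
    have "q \<noteq> 0"
      using ab by (auto simp: q_def b power2_eq_square field_simps)
    have "(\<lambda>n. v n / (1 / (real n)\<^sup>2)) \<longlonglongrightarrow> q"
      using lim True by (simp add: mult.commute)
    then have "v \<in> \<Theta>(\<lambda>n. 1 / (real n)\<^sup>2)"
      using \<open>q \<noteq> 0\<close> by (intro bigthetaI_tendsto[of q] eventually_mono[OF eventually_gt_at_top[of 0]]) auto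
    then show ?thesis
      by (simp add: bigtheta_def bigomega_iff_bigo)
  next
    case False
    have "(\<lambda>n. 1 / real n) \<longlonglongrightarrow> 0"
      by real_asymp
    from tendsto_add[OF tendsto_mult[OF lim this] tendsto_const[of p]]
    have "(\<lambda>n. ((real n)\<^sup>2 * v n - p * real n) * (1 / real n) + p) \<longlonglongrightarrow> p"
      by simp
    moreover have "\<forall>\<^sub>F n in sequentially.
        ((real n)\<^sup>2 * v n - p * real n) * (1 / real n) + p = v n / (1 / real n)"
      using eventually_gt_at_top[of 0]
      by eventually_elim (simp add: power2_eq_square field_simps)
    ultimately have "(\<lambda>n. v n / (1 / real n)) \<longlonglongrightarrow> p"
      by (rule Lim_transform_eventually)
    then have "v \<in> \<Theta>(\<lambda>n. 1 / real n)"
      using False by (intro bigthetaI_tendsto[of p] eventually_mono[OF eventually_gt_at_top[of 0]]) auto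
    then have "(\<lambda>n. 1 / real n) \<in> O(v)"
      by (simp add: bigtheta_def bigomega_iff_bigo)
    moreover have "(\<lambda>n. 1 / (real n)\<^sup>2) \<in> O(\<lambda>n. 1 / real n)"
      by real_asymp
    ultimately show ?thesis
      by (rule landau_o.big.trans[rotated])
  qed
qed

theorem mainTheorem3:
  fixes w :: "real \<Rightarrow> real \<Rightarrow> nat \<Rightarrow> real"
  assumes w: "\<And>a b. \<forall>\<^sub>F n in sequentially.
      1 / exp 1 * (1 + 1 / real n) ^ n = (real n + a) / (real n + b) * exp (w a b n)"
  shows "w (5 / 12) (11 / 12) \<longlonglongrightarrow> 0 \<and>
    (\<forall>a b. (a, b) \<noteq> (5 / 12, 11 / 12) \<longrightarrow> w (5 / 12) (11 / 12) \<in> o(w a b))"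
proof -
  let ?v = "w (5 / 12) (11 / 12)"
  have "(\<lambda>n. (real n)\<^sup>2 * ?v n) \<longlonglongrightarrow> 0"
    using relative_error_expansion[OF w, of "5 / 12" "11 / 12"] by (simp add: power2_eq_square)
  then have small: "?v \<in> o(\<lambda>n. 1 / (real n)\<^sup>2)"
    by (intro smalloI_tendsto eventually_mono[OF eventually_gt_at_top[of 0]])
      (auto simp: mult.commute)
  have "(\<lambda>n. 1 / (real n)\<^sup>2) \<in> O(\<lambda>_. 1 :: real)"
    by real_asymp
  with small have "?v \<in> o(\<lambda>_. 1)"
    by (rule landau_o.small_big_trans)
  then have "?v \<longlonglongrightarrow> 0"
    using smalloD_tendsto by fastforce
  moreover have "?v \<in> o(w a b)" if "(a, b) \<noteq> (5 / 12, 11 / 12)" for a b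
    using small relative_error_lower_bound[OF w that] by (rule landau_o.small_big_trans)
  ultimately show ?thesis
    by blast
qed

end
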